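(* Let $b\in\{-1,1\}$ and $f_{1,b}(n)=n+b$. Then $$\delta(\mathcal{M}_{f_{1,b}})=2\,\delta(\mathfrak{P})-\frac14\in[0.50801,\,0.50966].$$
   Context: $\mathbb{N}$ denotes the set of positive integers. For an integer $k\ge 0$ and $n\in\mathbb{N}$, $S_k(n):=\sum_{j=1}^n j^k$ (so $S_0(n)=n$). For a function $f$ on $\mathbb{N}$ with non-negative integer values, $\mathcal{M}_f:=\{n\in\mathbb{N}: n\text{ divides }S_{f(n)}(n)\}$. The set $\mathfrak{P}:=\{n\in\mathbb{N}: n\text{ odd and } S_{\frac{n-1}{2}}(n)\equiv 0\ (\mathrm{mod}\ n)\}$. For $A\subseteq\mathbb{N}$, $\delta(A)=\lim_{N\to\infty}\frac{1}{N}\,\mathrm{card}(A\cap[1,N])$ denotes the asymptotic density (the densities appearing exist). *)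

theory Defs
  imports Complex_Main "HOL-Number_Theory.Cong"
begin

definition power_sum :: "nat \<Rightarrow> nat \<Rightarrow> nat" where
  "power_sum k n = (\<Sum>j=1..n. j ^ k)"

definition M_set :: "(nat \<Rightarrow> nat) \<Rightarrow> nat set" where
  "M_set f = {n. n \<ge> 1 \<and> n dvd power_sum (f n) n}"

(* The shift b may be -1. The truncation in nat is harmless for n >= 1 and b >= -1. *)
definition f1 :: "int \<Rightarrow> nat \<Rightarrow> nat" where
  "f1 b n = nat (int n + b)"

(* For odd n the natural-number division is exact. *)
definition P_set :: "nat set" where
  "P_set = {n. n \<ge> 1 \<and> odd n \<and> [power_sum ((n - 1) div 2) n = 0] (mod n)}"

definition density_ratio :: "nat set \<Rightarrow> nat \<Rightarrow> real" where
  "density_ratio A N = real (card (A \<inter> {1..N})) / real N"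

definition has_density :: "nat set \<Rightarrow> bool" where
  "has_density A \<longleftrightarrow> convergent (density_ratio A)"

(* Meaningful only for sets satisfying has_density: lim is total. *)
definition density :: "nat set \<Rightarrow> real" where
  "density A = lim (density_ratio A)"

end

theory Submission
  imports Defs "HOL-Number_Theory.Number_Theory"
begin

text \<open>
  Two elementary facts turn both sets into sieves. For odd \<open>n\<close> and \<open>k \<ge> 1\<close>, splitting the sum into
  blocks shows that modulo \<open>p\<^sup>v\<close>, where \<open>p\<^sup>v\<close> divides \<open>n\<close> and \<open>v \<ge> 1\<close>, the sum \<open>S\<^sub>k(n)\<close> is
  \<open>(n div p) S\<^sub>k(p)\<close>; and \<open>S\<^sub>k(p)\<close> is \<open>-1\<close> or \<open>0\<close> modulo \<open>p\<close> according to whether \<open>p - 1\<close> divides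
  \<open>k\<close>. So \<open>n\<close> divides \<open>S\<^sub>k(n)\<close> iff no prime \<open>p\<close> dividing \<open>n\<close> has \<open>p - 1\<close> dividing \<open>k\<close>
  (\<open>dvd_power_sum_iff_odd\<close>). For even \<open>n\<close> and odd \<open>k\<close>, pairing \<open>j\<close> with \<open>n - j\<close> leaves \<open>(n/2)\<^sup>k\<close>
  modulo \<open>n\<close>, so for \<open>k > 1\<close> the multiples of 4 divide their power sum and the numbers \<open>2 mod 4\<close> do not.

  For \<open>c \<in> {1, 2}\<close> and \<open>b \<in> {-1, 1}\<close> let \<open>excluded c b p\<close> consist of the \<open>n\<close> divisible by \<open>p\<close> with
  \<open>c (p - 1)\<close> dividing \<open>n + b\<close>, and let \<open>survivors c b\<close> be the numbers \<open>n\<close> with \<open>c\<close> dividing \<open>n + b\<close>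
  that lie in no excluded set of an odd prime. Then the set for \<open>n + b\<close> is \<open>survivors 1 b\<close> without
  the class \<open>2 mod 4\<close>, and the set for \<open>(n - 1)/2\<close> is \<open>survivors 2 (-1)\<close>.

  For finitely many primes, inclusion and exclusion runs over sets of primes with product \<open>P\<close> and with
  \<open>L\<close> the least common multiple of the numbers \<open>p - 1\<close>. The conditions \<open>n = 0\<close> modulo \<open>P\<close> and
  \<open>n = -b\<close> modulo \<open>c L\<close> define a class of density \<open>1 / (c P L)\<close> if \<open>P\<close> and \<open>L\<close> are coprime and
  are contradictory otherwise: the sign \<open>b\<close> does not matter and \<open>c\<close> is only a factor. Hence all
  survivor sets have density \<open>\<delta> / c\<close> with one number \<open>\<delta>\<close>, the \<open>limit_density\<close>
  (\<open>density_sieved\<close>), provided that the large primes are negligible. They are: apart from \<open>p\<close>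
  itself, \<open>excluded 1 b p\<close> has at most \<open>2 N / (p (p - 1))\<close> elements up to \<open>N\<close>, and the primes have density zero
  (\<open>density_ratio_sieved_le\<close>, \<open>density_survivors\<close>). The two densities are therefore \<open>\<delta> - 1/4\<close> and
  \<open>\<delta> / 2\<close>, which gives the identity.

  It remains to enclose \<open>\<delta>\<close>. From above, \<open>\<delta>\<close> is at most the sieve density for the primes up to 167.
  From below, the union bound is used for the primes above 48: each of them removes at most what is
  left of its class after sieving by 3, 5 and 7, and those above 961 remove together at most
  \<open>1 / (3 \<sqdot> 962)\<close>. The finite sieve densities are evaluated with integer arithmetic by a recursion that
  cuts off small contributions in the safe direction (\<open>estimate_bounds\<close>).
\<close>

section \<open>Divisibility of power sums\<close>

lemma power_sum_Suc_block:
  "power_sum k (r * Suc t) = power_sum k (r * t) + (\<Sum>i = 1..r. (i + r * t) ^ k)"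
proof -
  have "power_sum k (r * Suc t) = power_sum k (r * t) + (\<Sum>j = r * t + 1..r * t + r. j ^ k)"
    unfolding power_sum_def
    by (subst sum.ub_add_nat[symmetric]) (auto simp: algebra_simps)
  also have "(\<Sum>j = r * t + 1..r * t + r. j ^ k) = (\<Sum>i = 1..r. (i + r * t) ^ k)"
    using sum.shift_bounds_cl_nat_ivl[of "\<lambda>j. j ^ k" 1 "r * t" r] by (simp add: add.commute)
  finally show ?thesis .
qed

lemma power_sum_blocks: "[power_sum k (r * t) = t * power_sum k r] (mod r)"
proof (induction t)
  case 0
  then show ?case by (simp add: power_sum_def)
next
  case (Suc t)
  have "[(\<Sum>i = 1..r. (i + r * t) ^ k) = power_sum k r] (mod r)"
    unfolding power_sum_def by (intro cong_sum cong_pow) (simp add: cong_def)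
  from cong_add[OF Suc.IH this] show ?case
    unfolding power_sum_Suc_block by (simp add: algebra_simps)
qed

lemma power_cong_linear:
  fixes a x :: int
  shows "[(a + x) ^ k = a ^ k + int k * a ^ (k - 1) * x] (mod x\<^sup>2)"
proof (induction k)
  case (Suc k)
  have "(a + x) ^ Suc k = (a + x) * (a + x) ^ k" by simp
  also have "[\<dots> = (a + x) * (a ^ k + int k * a ^ (k - 1) * x)] (mod x\<^sup>2)"
    by (intro cong_mult Suc.IH) simp
  also have "(a + x) * (a ^ k + int k * a ^ (k - 1) * x) =
      a ^ Suc k + int (Suc k) * a ^ k * x + x\<^sup>2 * (int k * a ^ (k - 1))"
    by (cases k) (auto simp: algebra_simps power2_eq_square)
  also have "[\<dots> = a ^ Suc k + int (Suc k) * a ^ (Suc k - 1) * x] (mod x\<^sup>2)"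
    by (simp add: cong_def)
  finally show ?case .
qed simp

text \<open>
  Writing the \<open>s\<close>-th block as \<open>(i + r s)\<^sup>k\<close> and expanding to first order, the linear terms carry the
  factor \<open>r (0 + 1 + \<dots> + (p - 1)) = r p (p - 1) / 2\<close>, which vanishes modulo \<open>r p\<close> because \<open>p\<close> is odd;
  the quadratic ones vanish because \<open>p\<close> divides \<open>r\<close>.
\<close>
lemma power_sum_mult_block:
  assumes "p dvd r" "odd p"
  shows "[power_sum k (r * p) = p * power_sum k r] (mod r * p)"
proof -
  have split: "power_sum k (r * t) = (\<Sum>s<t. \<Sum>i = 1..r. (i + r * s) ^ k)" for t
  proof (induction t)
    case (Suc t)
    then show ?case unfolding power_sum_Suc_block by simp
  qed (simp add: power_sum_def)
  have dv: "int (r * p) dvd (int r)\<^sup>2"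
    using assms(1) by (auto simp: power2_eq_square)
  have "[(int i + int r * int s) ^ k = int i ^ k + int k * int i ^ (k - 1) * (int r * int s)]
      (mod int (r * p))" for i s
  proof -
    have "[(int i + int r * int s) ^ k = int i ^ k + int k * int i ^ (k - 1) * (int r * int s)]
      (mod (int r * int s)\<^sup>2)" by (rule power_cong_linear)
    moreover have "int (r * p) dvd (int r * int s)\<^sup>2"
      using dv by (simp add: power_mult_distrib)
    ultimately show ?thesis by (rule cong_dvd_modulus)
  qed
  then have "[int (power_sum k (r * p)) =
      (\<Sum>s<p. \<Sum>i = 1..r. int i ^ k + int k * int i ^ (k - 1) * (int r * int s))] (mod int (r * p))"
    unfolding split of_nat_sum of_nat_power of_nat_add of_nat_mult by (intro cong_sum) simp
  also have "(\<Sum>s<p. \<Sum>i = 1..r. int i ^ k + int k * int i ^ (k - 1) * (int r * int s)) =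
      int p * int (power_sum k r) +
      (\<Sum>i = 1..r. int k * int i ^ (k - 1)) * (int r * (\<Sum>s<p. int s))"
    by (simp add: sum.distrib power_sum_def sum_distrib_left sum_distrib_right mult_ac)
       (subst sum.swap, simp)
  also have "(\<Sum>s<p. int s) = int p * (int (p - 1) div 2)"
  proof -
    obtain q where q: "p = 2 * q + 1" using assms(2) by (elim oddE)
    have "(\<Sum>s<n. int s) * 2 = int n * (int n - 1)" for n
      by (induction n) (auto simp: algebra_simps)
    from this[of p] show ?thesis unfolding q by (simp add: algebra_simps)
  qed
  also have "[int p * int (power_sum k r) +
      (\<Sum>i = 1..r. int k * int i ^ (k - 1)) * (int r * (int p * (int (p - 1) div 2))) =
      int p * int (power_sum k r)] (mod int (r * p))"
    by (simp add: cong_iff_dvd_diff)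
  finally show ?thesis by (simp flip: cong_int_iff)
qed

lemma power_sum_prime_power:
  assumes "odd p"
  shows "[power_sum k (p ^ Suc v) = p ^ v * power_sum k p] (mod p ^ Suc v)"
proof (induction v)
  case (Suc v)
  have "[power_sum k (p ^ Suc v * p) = p * power_sum k (p ^ Suc v)] (mod p ^ Suc v * p)"
    by (rule power_sum_mult_block) (use assms in auto)
  also have "[p * power_sum k (p ^ Suc v) = p * (p ^ v * power_sum k p)] (mod p ^ Suc v * p)"
    using Suc.IH by (simp add: cong_def mult.commute[of _ p] flip: mult_mod_right)
  finally show ?case by (simp add: mult_ac)
qed simp

lemma power_sum_prime_cong:
  assumes "prime p" "p - 1 dvd k" "k > 0"
  shows "[power_sum k p = p - 1] (mod p)"
proof -
  have p1: "p > 1" using assms(1) by (rule prime_gt_1_nat)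
  have "power_sum k p = (\<Sum>j = 1..p - 1. j ^ k) + p ^ k"
    unfolding power_sum_def using p1 by (cases p) auto
  also have "[(\<Sum>j = 1..p - 1. j ^ k) + p ^ k = (\<Sum>j = 1..p - 1. 1) + 0] (mod p)"
  proof (intro cong_add cong_sum)
    fix j assume "j \<in> {1..p - 1}"
    then have "\<not> p dvd j" using p1 by (auto dest: dvd_imp_le)
    with assms(1) have "[j ^ (p - 1) = 1] (mod p)" by (rule fermat_theorem)
    moreover obtain m where "k = (p - 1) * m" using assms(2) by blast
    ultimately show "[j ^ k = 1] (mod p)" using cong_pow[of "j ^ (p - 1)" 1 p m] by (simp add: power_mult)
  qed (use assms in \<open>auto simp: cong_0_iff\<close>)
  finally show ?thesis by simp
qed

text \<open>
  Over the powers of a primitive root \<open>g\<close> the sum is geometric with ratio \<open>g\<^sup>k\<close>. Its multiple by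
  \<open>g\<^sup>k - 1\<close> is \<open>0\<close> modulo \<open>p\<close>, and \<open>g\<^sup>k - 1\<close> itself is not.
\<close>
lemma prime_dvd_power_sum:
  assumes "prime p" "\<not> p - 1 dvd k"
  shows "p dvd power_sum k p"
proof -
  have p1: "p > 1" using assms(1) by (rule prime_gt_1_nat)
  have k: "k > 0" using assms(2) by (cases k) auto
  obtain g where g: "residue_primroot p g"
    using prime_primitive_root_exists[of p] assms(1) p1 by auto
  have cop: "coprime p g" using g by (simp add: residue_primroot_def)
  have ng: "\<not> [g ^ k = 1] (mod p)"
    using g assms ord_divides[of g k p] by (auto simp: residue_primroot_def totient_prime)
  have "bij_betw (\<lambda>i. g ^ i mod p) {..<totient p} (totatives p)"
    using p1 g by (intro residue_primroot_is_generator)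
  then have bij: "bij_betw (\<lambda>i. g ^ i mod p) {..<p - 1} {0<..<p}"
    using assms(1) by (simp add: totient_prime totatives_prime)
  have "power_sum k p = (\<Sum>j\<in>{0<..<p}. j ^ k) + p ^ k"
  proof -
    have "{1..p} = insert p {0<..<p}" using p1 by auto
    then show ?thesis by (simp add: power_sum_def)
  qed
  also have "(\<Sum>j\<in>{0<..<p}. j ^ k) = (\<Sum>i<p - 1. (g ^ i mod p) ^ k)"
    by (rule sum.reindex_bij_betw[OF bij, symmetric])
  also have "[(\<Sum>i<p - 1. (g ^ i mod p) ^ k) + p ^ k = (\<Sum>i<p - 1. (g ^ k) ^ i) + 0] (mod p)"
  proof (intro cong_add cong_sum)
    fix i show "[(g ^ i mod p) ^ k = (g ^ k) ^ i] (mod p)"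
      by (simp add: cong_def power_mod mult.commute flip: power_mult)
  qed (use k in \<open>auto simp: cong_0_iff\<close>)
  finally have "[int (power_sum k p) = (\<Sum>i<p - 1. (int g ^ k) ^ i)] (mod int p)"
    by (simp flip: cong_int_iff)
  then have "[(int g ^ k - 1) * int (power_sum k p) =
      (int g ^ k - 1) * (\<Sum>i<p - 1. (int g ^ k) ^ i)] (mod int p)"
    by (intro cong_mult) simp_all
  also have "(int g ^ k - 1) * (\<Sum>i<p - 1. (int g ^ k) ^ i) = (int g ^ (p - 1)) ^ k - 1"
    by (subst power_diff_1_eq[symmetric]) (simp add: mult.commute flip: power_mult)
  also have "[(int g ^ (p - 1)) ^ k - 1 = 1 ^ k - 1] (mod int p)"
  proof (intro cong_diff cong_pow)
    have "\<not> p dvd g"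
      using cop p1 by (metis coprime_absorb_left not_is_unit_0 nat_dvd_1_iff_1 less_irrefl)
    then have "[g ^ (p - 1) = 1] (mod p)" using assms(1) by (intro fermat_theorem)
    then show "[int g ^ (p - 1) = 1] (mod int p)"
      by (metis cong_int_iff of_nat_1 of_nat_power)
  qed simp
  finally have "int p dvd (int g ^ k - 1) * int (power_sum k p)"
    by (simp add: cong_0_iff)
  moreover have "\<not> int p dvd int g ^ k - 1"
    using ng by (metis cong_iff_dvd_diff cong_int_iff of_nat_1 of_nat_power)
  moreover have "prime (int p)" using assms(1) by simp
  ultimately have "int p dvd int (power_sum k p)"
    using prime_dvd_multD by blast
  then show ?thesis by simp
qed

text \<open>
  Divisibility is tested at the exact power of each prime \<open>p\<close> in \<open>n\<close>: there the sum reduces to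
  \<open>n / p\<close> times the sum up to \<open>p\<close>, so exactly one factor \<open>p\<close> has to come from the latter.
\<close>
theorem dvd_power_sum_iff_odd:
  assumes "odd n" "k > 0"
  shows "n dvd power_sum k n \<longleftrightarrow> (\<forall>p. prime p \<and> p dvd n \<longrightarrow> \<not> p - 1 dvd k)"
proof (intro iffI allI impI)
  fix p assume dvd: "n dvd power_sum k n" and p: "prime p \<and> p dvd n"
  have oddp: "odd p" using p assms(1) by (meson dvd_trans)
  have n0: "n \<noteq> 0" using assms(1) by (cases n) auto
  have "multiplicity p n > 0" using p n0 by (simp add: prime_multiplicity_gt_zero_iff)
  then obtain v where v: "multiplicity p n = Suc v" by (cases "multiplicity p n") auto
  have p1: "p > 1" using p prime_gt_1_nat by blast
  obtain m where m: "n = p ^ Suc v * m" "\<not> p dvd m"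
    using multiplicity_decompose'[of n p] n0 p p1 v by auto
  have "[power_sum k n = m * (p ^ v * power_sum k p)] (mod p ^ Suc v)"
    unfolding m(1) using power_sum_blocks cong_mult[OF cong_refl power_sum_prime_power[OF oddp]]
    by (rule cong_trans)
  moreover have "p ^ Suc v dvd power_sum k n"
    using dvd m(1) by (metis dvd_mult_left)
  ultimately have "p ^ Suc v dvd m * (p ^ v * power_sum k p)"
    using cong_dvd_iff by blast
  then have "p ^ v * p dvd p ^ v * (m * power_sum k p)" by (simp add: mult_ac)
  then have "p dvd m * power_sum k p" using p by (auto simp: prime_gt_0_nat)
  then have S: "p dvd power_sum k p" using m(2) p prime_dvd_multD by blast
  show "\<not> p - 1 dvd k"
  proof
    assume "p - 1 dvd k"
    from power_sum_prime_cong[OF _ this assms(2)] p S have "p dvd p - 1"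
      using cong_dvd_iff by blast
    then show False using p1 by (auto dest!: dvd_imp_le)
  qed
next
  assume *: "\<forall>p. prime p \<and> p dvd n \<longrightarrow> \<not> p - 1 dvd k"
  have n0: "n \<noteq> 0" using assms(1) by (cases n) auto
  have S0: "power_sum k n \<noteq> 0" using n0 by (auto simp: power_sum_def)
  show "n dvd power_sum k n"
  proof (rule multiplicity_le_imp_dvd[OF n0])
    fix p :: nat assume p: "prime p"
    show "multiplicity p n \<le> multiplicity p (power_sum k n)"
    proof (cases "multiplicity p n")
      case (Suc v)
      have "p ^ Suc v dvd n" using Suc by (metis multiplicity_dvd)
      then obtain m where m: "n = p ^ Suc v * m" by blast
      then have "p dvd n" by simp
      then have oddp: "odd p" and "p dvd power_sum k p"
        using * p assms(1) prime_dvd_power_sum by (meson dvd_trans)+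
      have "[power_sum k n = m * (p ^ v * power_sum k p)] (mod p ^ Suc v)"
        unfolding m using power_sum_blocks cong_mult[OF cong_refl power_sum_prime_power[OF oddp]]
        by (rule cong_trans)
      moreover have "p ^ Suc v dvd m * (p ^ v * power_sum k p)"
        using \<open>p dvd power_sum k p\<close> by (simp add: mult_dvd_mono)
      ultimately have "p ^ Suc v dvd power_sum k n"
        using cong_dvd_iff by blast
      then show ?thesis unfolding Suc using S0 p
        by (intro multiplicity_geI) (auto simp: prime_gt_1_nat)
    qed simp
  qed
qed

text \<open>
  For odd \<open>k\<close> the terms of \<open>j\<close> and \<open>2 m - j\<close> cancel modulo \<open>2 m\<close>; only the middle term and the
  last one have no partner.
\<close>
lemma power_sum_even_cong:
  assumes "odd k"
  shows "[power_sum k (2 * m) = m ^ k] (mod 2 * m)"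
proof (cases "m = 0")
  case False
  have k: "k > 0" using assms by (cases k) auto
  have "{1..2 * m} = {1..<m} \<union> {m} \<union> {m<..<2 * m} \<union> {2 * m}" using False by auto
  then have "power_sum k (2 * m) = (\<Sum>j\<in>{1..<m} \<union> {m} \<union> {m<..<2 * m} \<union> {2 * m}. j ^ k)"
    by (simp add: power_sum_def)
  also have "\<dots> = (\<Sum>j\<in>{1..<m}. j ^ k) + m ^ k + (\<Sum>j\<in>{m<..<2 * m}. j ^ k) + (2 * m) ^ k"
    using False by (subst sum.union_disjoint; (subst sum.union_disjoint)?; (subst sum.union_disjoint)?; auto)
  also have "(\<Sum>j\<in>{m<..<2 * m}. j ^ k) = (\<Sum>j\<in>{1..<m}. (2 * m - j) ^ k)"
    by (rule sum.reindex_bij_witness[of _ "\<lambda>j. 2 * m - j" "\<lambda>j. 2 * m - j"]) auto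
  finally have eq: "power_sum k (2 * m) =
      (\<Sum>j\<in>{1..<m}. j ^ k + (2 * m - j) ^ k) + (m ^ k + (2 * m) ^ k)"
    by (simp add: sum.distrib)
  have "2 * m dvd j ^ k + (2 * m - j) ^ k" if "j \<in> {1..<m}" for j
  proof -
    have "[int (2 * m - j) = - int j] (mod int (2 * m))"
      using that by (simp add: cong_iff_dvd_diff of_nat_diff)
    then have "[int j ^ k + int (2 * m - j) ^ k = int j ^ k + (- int j) ^ k] (mod int (2 * m))"
      by (intro cong_add cong_pow) simp_all
    then have "int (2 * m) dvd int (j ^ k + (2 * m - j) ^ k)"
      using assms by (simp add: cong_0_iff)
    then show ?thesis by (simp only: of_nat_dvd_iff)
  qed
  then have "[(\<Sum>j\<in>{1..<m}. j ^ k + (2 * m - j) ^ k) = 0] (mod 2 * m)"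
    unfolding cong_0_iff by (rule dvd_sum)
  moreover have "[(2 * m) ^ k = 0] (mod 2 * m)"
    unfolding cong_0_iff using k by (intro dvd_power) simp
  ultimately have "[(\<Sum>j\<in>{1..<m}. j ^ k + (2 * m - j) ^ k) + (m ^ k + (2 * m) ^ k) = 0 + (m ^ k + 0)] (mod 2 * m)"
    by (intro cong_add cong_refl)
  then show ?thesis unfolding eq by simp
qed (use assms in \<open>auto simp: power_sum_def odd_pos\<close>)

lemma dvd_power_sum_iff_even:
  assumes "odd k" "k > 1 \<or> \<not> 4 dvd n" "even n" "n > 0"
  shows "n dvd power_sum k n \<longleftrightarrow> 4 dvd n"
proof -
  obtain m where m: "n = 2 * m" using assms(3) by blast
  have "n dvd power_sum k n \<longleftrightarrow> 2 * m dvd m ^ k"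
    unfolding m using power_sum_even_cong[OF assms(1)] by (rule cong_dvd_iff)
  also have "\<dots> \<longleftrightarrow> even m"
  proof
    assume "2 * m dvd m ^ k"
    then show "even m" by (meson dvd_mult_left even_power)
  next
    assume "even m"
    then have "2 * m dvd m ^ 2" by (auto simp: power2_eq_square)
    moreover have "k \<ge> 2" using assms(2) \<open>even m\<close> by (auto simp: m)
    ultimately show "2 * m dvd m ^ k" by (meson dvd_trans le_imp_power_dvd)
  qed
  also have "\<dots> \<longleftrightarrow> 4 dvd n" by (auto simp: m)
  finally show ?thesis .
qed

section \<open>The primes have density zero\<close>

lemma prod_primes_dvd:
  fixes x :: nat
  assumes "finite P" "\<And>p. p \<in> P \<Longrightarrow> prime p" "\<And>p. p \<in> P \<Longrightarrow> p dvd x"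
  shows "\<Prod>P dvd x"
  using assms
proof (induction P rule: finite_induct)
  case (insert p P)
  have "coprime p (\<Prod>P)"
    using insert by (intro prod_coprime_right) (metis insertCI primes_coprime)
  then show ?case using insert by (simp add: divides_mult)
qed simp

text \<open>
  This is the classical argument of Erdos: for odd \<open>n = 2 m + 1\<close> the primes in \<open>(m + 1, n]\<close> all
  divide the binomial coefficient \<open>n\<close> over \<open>m\<close>, which occurs twice in a row with sum \<open>2 \<sqdot> 4\<^sup>m\<close>.
\<close>
lemma primorial_le: "(\<Prod>p | prime p \<and> p \<le> n. p) \<le> 4 ^ (n::nat)"
proof (induction n rule: less_induct)
  case (less n)
  consider "n \<le> 2" | "n > 2" "even n" | "n > 2" "odd n" by fastforce
  then show ?case
  proof cases
    case 1
    have "{p. prime p \<and> p \<le> n} \<subseteq> (if n = 2 then {2} else {})"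
      using 1 by (auto dest: prime_ge_2_nat)
    then have "{p. prime p \<and> p \<le> n} = (if n = 2 then {2} else {})" by auto
    then show ?thesis by simp
  next
    case 2
    then have "\<not> prime n" using prime_odd_nat by blast
    then have "{p. prime p \<and> p \<le> n} = {p. prime p \<and> p \<le> n - 1}"
      by (metis One_nat_def Suc_pred' 2(1) le_SucE le_SucI less_imp_Suc_add zero_less_Suc)
    then have "(\<Prod>p | prime p \<and> p \<le> n. p) \<le> 4 ^ (n - 1)" using less[of "n - 1"] 2 by simp
    also have "\<dots> \<le> 4 ^ n" by (rule power_increasing) simp_all
    finally show ?thesis .
  next
    case 3
    then obtain m where m: "n = 2 * m + 1" by (elim oddE)
    let ?A = "{p. prime p \<and> p \<le> m + 1}" and ?B = "{p. prime p \<and> m + 1 < p \<and> p \<le> n}"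
    have "{p. prime p \<and> p \<le> n} = ?A \<union> ?B" using m by auto
    moreover have "(\<Prod>p\<in>?A \<union> ?B. p) = \<Prod>?A * \<Prod>?B"
      by (subst prod.union_disjoint) auto
    moreover have "\<Prod>?A \<le> 4 ^ (m + 1)" using less[of "m + 1"] 3 m by simp
    moreover have "\<Prod>?B \<le> 4 ^ m"
    proof -
      have "\<Prod>?B dvd (n choose m)"
      proof (rule prod_primes_dvd)
        fix p assume p: "p \<in> ?B"
        then have "\<not> p dvd fact m * fact (n - m)"
          using m by (auto simp: prime_dvd_mult_iff prime_dvd_fact_iff simp del: fact_Suc)
        moreover have "p dvd fact m * fact (n - m) * (n choose m)"
          using p m by (subst binomial_fact_lemma) (auto simp: prime_dvd_fact_iff simp del: fact_Suc)
        ultimately show "p dvd (n choose m)" using p prime_dvd_mult_iff by blast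
      qed auto
      then have "\<Prod>?B \<le> (n choose m)" using m by (intro dvd_imp_le) auto
      also have "2 * (n choose m) = (\<Sum>k\<in>{m, m + 1}. n choose k)"
        using m binomial_symmetric[of m n] by simp
      also have "\<dots> \<le> (\<Sum>k\<le>n. n choose k)" using m by (intro sum_mono2) auto
      also have "\<dots> = 2 * 4 ^ m" unfolding m by (subst choose_row_sum) (simp add: power_mult)
      finally show ?thesis by simp
    qed
    ultimately have "(\<Prod>p | prime p \<and> p \<le> n. p) \<le> 4 ^ (m + 1) * 4 ^ m"
      by (simp only: mult_mono zero_le)
    then show ?thesis unfolding m by (simp add: power_add mult_2)
  qed
qed

text \<open>
  Each of the primes above \<open>K\<close> contributes a factor larger than \<open>K\<close> to the primorial. Since \<open>K\<close> is
  arbitrary, the bound already gives density zero.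
\<close>
lemma card_primes_le:
  assumes "K \<ge> 2"
  shows "real (card {p. prime p \<and> p \<le> n}) \<le> real K + real n * (ln 4 / ln (real K))"
proof -
  let ?A = "{p. prime p \<and> p \<le> n}" let ?B = "{p \<in> ?A. K < p}"
  have "K ^ card ?B = (\<Prod>p\<in>?B. K)" by simp
  also have "\<dots> \<le> \<Prod>?B" by (rule prod_mono) auto
  also have "\<dots> \<le> \<Prod>?A"
    by (intro dvd_imp_le prod_dvd_prod_subset) (auto intro!: prod_pos simp: prime_gt_0_nat)
  also have "\<dots> \<le> 4 ^ n" by (rule primorial_le)
  finally have "real (K ^ card ?B) \<le> real (4 ^ n)" by (simp only: of_nat_le_iff)
  then have "ln (real K ^ card ?B) \<le> ln (4 ^ n)"
    using assms by (subst ln_le_cancel_iff) auto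
  then have "card ?B * ln (real K) \<le> n * ln 4"
    using assms by (simp add: ln_realpow)
  then have "card ?B \<le> n * (ln 4 / ln (real K))"
    using assms by (simp add: field_simps)
  moreover have "card ?A \<le> card {1..K} + card ?B"
  proof -
    have "?A \<subseteq> {1..K} \<union> ?B" by (auto simp: Suc_le_eq prime_gt_0_nat)
    then have "card ?A \<le> card ({1..K} \<union> ?B)" by (intro card_mono) auto
    also have "\<dots> \<le> card {1..K} + card ?B" by (rule card_Un_le)
    finally show ?thesis .
  qed
  ultimately show ?thesis by simp
qed

lemma primes_density_zero: "(\<lambda>n. real (card {p. prime p \<and> p \<le> n}) / real n) \<longlonglongrightarrow> 0"
proof (rule LIMSEQ_I)
  fix e :: real assume e: "e > 0"
  define K where "K = nat \<lceil>exp (4 * ln 4 / e)\<rceil> + 2"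
  have K: "K \<ge> 2" "real K > exp (4 * ln 4 / e)" unfolding K_def by linarith+
  then have "ln (real K) > 4 * ln 4 / e"
    by (metis exp_gt_zero exp_less_cancel_iff exp_ln order.strict_trans)
  then have lnK: "ln 4 / ln (real K) \<le> e / 4"
    using e K by (auto simp: field_simps intro: less_imp_le)
  have "real (card {p. prime p \<and> p \<le> n}) / real n < e" if n: "n \<ge> nat \<lceil>2 * real K / e\<rceil> + 1" for n
  proof -
    have "real n > 2 * real K / e" using n by linarith
    then have "real K < e / 2 * real n" using e by (simp add: field_simps)
    moreover have "real n * (ln 4 / ln (real K)) \<le> real n * (e / 4)"
      by (intro mult_left_mono lnK) simp
    ultimately have "real (card {p. prime p \<and> p \<le> n}) < e * real n"
      using card_primes_le[OF K(1), of n] e n by (simp add: mult.commute)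
    then show ?thesis using n by (simp add: field_simps)
  qed
  then show "\<exists>no. \<forall>n\<ge>no. norm (real (card {p. prime p \<and> p \<le> n}) / real n - 0) < e"
    by (intro exI[of _ "nat \<lceil>2 * real K / e\<rceil> + 1"]) auto
qed

section \<open>Densities of sieved residue classes\<close>

text \<open>
  Modulus and residues are integers so that \<open>n - 1\<close> and \<open>n + 1\<close> are treated alike and the later
  computations run on binary numerals.
\<close>
definition excluded :: "int \<Rightarrow> int \<Rightarrow> int \<Rightarrow> nat set" where
  "excluded c b p = {n. p dvd int n \<and> c * (p - 1) dvd int n + b}"

text \<open>
  The density, for \<open>c = 1\<close>, of the class given by \<open>P dvd n\<close> and \<open>L dvd n + b\<close> after removal of the
  excluded sets of the listed primes. Removing one more prime \<open>q\<close> takes away the part of the class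
  that lies in the excluded set of \<open>q\<close>, and this part is a class of the same kind.
\<close>
primrec sieve_density :: "int list \<Rightarrow> int \<Rightarrow> int \<Rightarrow> real" where
  "sieve_density [] P L = (if coprime P L then 1 / real_of_int (P * L) else 0)"
| "sieve_density (q # qs) P L = sieve_density qs P L - sieve_density qs (lcm P q) (lcm L (q - 1))"

definition sieved :: "int \<Rightarrow> int \<Rightarrow> int list \<Rightarrow> int \<Rightarrow> int \<Rightarrow> nat set" where
  "sieved c b qs P L = {n. P dvd int n \<and> c * L dvd int n + b \<and> (\<forall>q\<in>set qs. n \<notin> excluded c b q)}"

lemma density_ratio_diff:
  assumes "density_ratio A \<longlonglongrightarrow> x" "density_ratio B \<longlonglongrightarrow> y" "B \<subseteq> A"
  shows "density_ratio (A - B) \<longlonglongrightarrow> x - y"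
proof -
  have "density_ratio (A - B) = (\<lambda>N. density_ratio A N - density_ratio B N)"
  proof
    fix N
    have "(A - B) \<inter> {1..N} = A \<inter> {1..N} - B \<inter> {1..N}" by auto
    then have "card ((A - B) \<inter> {1..N}) = card (A \<inter> {1..N}) - card (B \<inter> {1..N})"
      using assms(3) by (simp only:) (intro card_Diff_subset; auto)
    moreover have "card (B \<inter> {1..N}) \<le> card (A \<inter> {1..N})"
      using assms(3) by (intro card_mono) auto
    ultimately show "density_ratio (A - B) N = density_ratio A N - density_ratio B N"
      by (simp add: density_ratio_def of_nat_diff diff_divide_distrib)
  qed
  then show ?thesis using tendsto_diff[OF assms(1,2)] by simp
qed

lemma density_ratio_mono: "A \<subseteq> B \<Longrightarrow> density_ratio A N \<le> density_ratio B N"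
  unfolding density_ratio_def by (intro divide_right_mono) (auto intro!: card_mono)

lemma density_ratio_nonneg: "density_ratio A N \<ge> 0"
  by (simp add: density_ratio_def)

lemma density_ratio_cong:
  assumes "\<And>n. n \<ge> 1 \<Longrightarrow> n \<in> A \<longleftrightarrow> n \<in> B"
  shows "density_ratio A = density_ratio B"
proof
  fix N
  have "A \<inter> {1..N} = B \<inter> {1..N}" using assms by auto
  then show "density_ratio A N = density_ratio B N" by (simp add: density_ratio_def)
qed

text \<open>
  Whole periods are counted exactly, so up to \<open>N\<close> the count differs from \<open>N / m\<close> by at most 2.
\<close>
lemma density_arith_progression:
  fixes m r :: int
  assumes "m > 0"
  shows "density_ratio {n. [int n = r] (mod m)} \<longlonglongrightarrow> 1 / m"
proof -
  let ?A = "{n. [int n = r] (mod m)}"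
  define M where "M = nat m"
  define s where "s = nat (r mod m)"
  have M: "M > 0" "int M = m" using assms by (auto simp: M_def)
  have s: "s < M" "int s = r mod m" using assms by (auto simp: M_def s_def nat_less_iff)
  have A: "n \<in> ?A \<longleftrightarrow> n mod M = s" for n
    using M(2) s(2) by (auto simp: cong_def simp flip: of_nat_mod)
  have card_eq: "card (?A \<inter> {..<M * t}) = t" for t
  proof -
    have "bij_betw (\<lambda>i. M * i + s) {..<t} (?A \<inter> {..<M * t})"
    proof (rule bij_betwI[where g = "\<lambda>n. n div M"])
      show "(\<lambda>i. M * i + s) \<in> {..<t} \<rightarrow> ?A \<inter> {..<M * t}"
      proof
        fix i assume "i \<in> {..<t}"
        then have "M * Suc i \<le> M * t" by (intro mult_left_mono) auto
        then show "M * i + s \<in> ?A \<inter> {..<M * t}" using s(1) A by simp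
      qed
    qed (use s M A in \<open>auto simp: less_mult_imp_div_less mult.commute\<close>)
    then show ?thesis by (metis bij_betw_same_card card_lessThan)
  qed
  have bounds: "\<bar>density_ratio ?A N - 1 / m\<bar> \<le> 2 / real N" if N: "N > 0" for N
  proof -
    let ?t = "N div M"
    have "?A \<inter> {..<M * ?t} \<subseteq> insert 0 (?A \<inter> {1..N})"
    proof
      fix n assume n: "n \<in> ?A \<inter> {..<M * ?t}"
      then have "n < M * ?t" by simp
      also have "\<dots> \<le> N" by (rule times_div_less_eq_dividend)
      finally show "n \<in> insert 0 (?A \<inter> {1..N})" using n by auto
    qed
    then have "card (?A \<inter> {..<M * ?t}) \<le> card (insert 0 (?A \<inter> {1..N}))"
      by (intro card_mono) auto
    also have "\<dots> \<le> Suc (card (?A \<inter> {1..N}))" by (rule card_insert_le_m1) auto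
    finally have 1: "?t \<le> Suc (card (?A \<inter> {1..N}))" using card_eq by simp
    have "N < M * Suc ?t" using M(1) by (simp add: dividend_less_times_div)
    then have "?A \<inter> {1..N} \<subseteq> ?A \<inter> {..<M * Suc ?t}" by auto
    then have "card (?A \<inter> {1..N}) \<le> card (?A \<inter> {..<M * Suc ?t})" by (intro card_mono) auto
    then have 2: "card (?A \<inter> {1..N}) \<le> Suc ?t" by (simp only: card_eq)
    have "real ?t \<le> real N / M" by (rule of_nat_div_le_of_nat)
    moreover have "real N \<le> real (M * Suc ?t)" using \<open>N < M * Suc ?t\<close> by (simp only: of_nat_le_iff)
    then have "real N / M \<le> real ?t + 1" using M(1) by (simp add: field_simps)
    ultimately have "\<bar>real (card (?A \<inter> {1..N})) - real N / m\<bar> \<le> 2"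
      using 1 2 unfolding M(2)[symmetric] by simp
    then have "\<bar>real (card (?A \<inter> {1..N})) - real N / m\<bar> / N \<le> 2 / N"
      by (rule divide_right_mono) simp
    moreover have "density_ratio ?A N - 1 / m = (real (card (?A \<inter> {1..N})) - real N / m) / N"
      using N by (simp add: density_ratio_def diff_divide_distrib)
    ultimately show ?thesis by simp
  qed
  have "(\<lambda>N. density_ratio ?A N - 1 / m) \<longlonglongrightarrow> 0"
  proof (rule tendsto_rabs_zero_cancel, rule tendsto_sandwich[of "\<lambda>_. 0" _ _ "\<lambda>N. 2 / real N"])
    show "\<forall>\<^sub>F N in sequentially. \<bar>density_ratio ?A N - 1 / m\<bar> \<le> 2 / real N"
      by (rule eventually_mono[OF eventually_gt_at_top[of 0] bounds])
    show "(\<lambda>N. 2 / real N) \<longlonglongrightarrow> 0" by (rule lim_const_over_n)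
  qed auto
  then show ?thesis by (simp add: LIM_zero_iff)
qed

text \<open>
  The value depends neither on \<open>b\<close> nor, up to the factor \<open>1 / c\<close>, on \<open>c\<close>: a common prime of \<open>P\<close> and
  \<open>c L\<close> would divide \<open>b = \<plusminus>1\<close>, so the class is empty, and \<open>P\<close> being odd, coprimality to \<open>L\<close> and to
  \<open>2 L\<close> is the same.
\<close>
lemma density_sieved:
  assumes "odd P" "P > 0" "L > 0" "c \<in> {1, 2}" "b \<in> {-1, 1}" "\<And>q. q \<in> set qs \<Longrightarrow> odd q \<and> q > 1"
  shows "density_ratio (sieved c b qs P L) \<longlonglongrightarrow> sieve_density qs P L / c"
  using assms
proof (induction qs arbitrary: P L)
  case (Cons q qs)
  have q: "odd q" "q > 1" using Cons.prems(6) by auto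
  have pos: "lcm P q > 0" "lcm L (q - 1) > 0"
    using Cons.prems(2,3) q(2) by (simp_all add: lcm_pos_int)
  have "lcm P q dvd P * q" by simp
  then have oddl: "odd (lcm P q)"
    using Cons.prems(1) q(1) by (meson dvd_trans even_mult_iff)
  have "c * lcm L (q - 1) = lcm (c * L) (c * (q - 1))"
    using Cons.prems(4) by (auto simp: lcm_mult_left normalize_mult)
  then have "c * lcm L (q - 1) dvd int n + b \<longleftrightarrow> c * L dvd int n + b \<and> c * (q - 1) dvd int n + b" for n
    by simp
  then have sub: "sieved c b qs (lcm P q) (lcm L (q - 1)) =
      {n \<in> sieved c b qs P L. n \<in> excluded c b q}"
    by (auto simp: sieved_def excluded_def)
  have "sieved c b (q # qs) P L = sieved c b qs P L - sieved c b qs (lcm P q) (lcm L (q - 1))"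
    unfolding sub by (auto simp: sieved_def)
  moreover have "density_ratio (sieved c b qs P L - sieved c b qs (lcm P q) (lcm L (q - 1)))
      \<longlonglongrightarrow> sieve_density qs P L / c - sieve_density qs (lcm P q) (lcm L (q - 1)) / c"
  proof (rule density_ratio_diff)
    show "density_ratio (sieved c b qs (lcm P q) (lcm L (q - 1)))
        \<longlonglongrightarrow> sieve_density qs (lcm P q) (lcm L (q - 1)) / c"
      using Cons.prems q oddl pos by (intro Cons.IH) auto
    show "density_ratio (sieved c b qs P L) \<longlonglongrightarrow> sieve_density qs P L / c"
      using Cons.prems by (intro Cons.IH) auto
    show "sieved c b qs (lcm P q) (lcm L (q - 1)) \<subseteq> sieved c b qs P L"
      unfolding sub by blast
  qed
  ultimately show ?case by (simp add: diff_divide_distrib)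
next
  case Nil
  have cop_iff: "coprime P (c * L) \<longleftrightarrow> coprime P L"
    using Nil by auto
  show ?case
  proof (cases "coprime P L")
    case True
    then have "coprime P (c * L)" using cop_iff by simp
    then obtain x where x: "[x = 0] (mod P)" "[x = - b] (mod c * L)"
      using binary_chinese_remainder_int by blast
    have "sieved c b [] P L = {n. [int n = x] (mod P * (c * L))}"
    proof -
      have "n \<in> sieved c b [] P L \<longleftrightarrow> [int n = x] (mod P) \<and> [int n = x] (mod c * L)" for n
      proof -
        have "P dvd int n \<longleftrightarrow> [int n = x] (mod P)"
          unfolding cong_0_iff[symmetric] using x(1) cong_sym cong_trans by meson
        moreover have "c * L dvd int n + b \<longleftrightarrow> [int n = x] (mod c * L)"
        proof -
          have "c * L dvd int n + b \<longleftrightarrow> [int n = - b] (mod c * L)"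
            by (simp add: cong_iff_dvd_diff)
          then show ?thesis using x(2) cong_sym cong_trans by meson
        qed
        ultimately show ?thesis by (simp add: sieved_def)
      qed
      moreover have "[int n = x] (mod P) \<and> [int n = x] (mod c * L) \<longleftrightarrow> [int n = x] (mod P * (c * L))" for n
        using coprime_cong_mult[OF _ _ \<open>coprime P (c * L)\<close>, of "int n" x]
          cong_dvd_modulus[of "int n" x "P * (c * L)" P] cong_dvd_modulus[of "int n" x "P * (c * L)" "c * L"]
        by auto
      ultimately show ?thesis by auto
    qed
    then show ?thesis
      using density_arith_progression[of "P * (c * L)" x] Nil True by (auto simp: mult_ac)
  next
    case False
    have "sieved c b [] P L = {}"
    proof (rule ccontr)
      assume "sieved c b [] P L \<noteq> {}"
      then obtain n where n: "P dvd int n" "c * L dvd int n + b" by (auto simp: sieved_def)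
      have "coprime P L"
      proof (rule coprimeI)
        fix d assume "d dvd P" "d dvd L"
        then have "d dvd int n" "d dvd int n + b"
          using n by (auto intro: dvd_trans dvd_mult_right)
        then have "d dvd b" using dvd_add_right_iff by blast
        then show "is_unit d" using Nil.prems(5) by auto
      qed
      then show False using False by simp
    qed
    then show ?thesis using False by (simp add: density_ratio_def)
  qed
qed

text \<open>
  The numbers \<open>sieve_density qs P L\<close> inherit positivity and monotonicity from the densities that they
  are.
\<close>
lemma sieve_density_nonneg:
  assumes "odd P" "P > 0" "L > 0" "\<And>q. q \<in> set qs \<Longrightarrow> odd q \<and> q > 1"
  shows "sieve_density qs P L \<ge> 0"
  using density_sieved[OF assms(1-3), of 1 1 qs] assms(4)
  by (auto intro: LIMSEQ_le_const simp: density_ratio_nonneg)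

lemma sieve_density_antimono:
  assumes "odd P" "P > 0" "L > 0" "\<And>q. q \<in> set qs' \<Longrightarrow> odd q \<and> q > 1" "set qs \<subseteq> set qs'"
  shows "sieve_density qs' P L \<le> sieve_density qs P L"
proof (rule LIMSEQ_le)
  show "density_ratio (sieved 1 1 qs' P L) \<longlonglongrightarrow> sieve_density qs' P L"
    using density_sieved[OF assms(1-3), of 1 1 qs'] assms(4) by simp
  show "density_ratio (sieved 1 1 qs P L) \<longlonglongrightarrow> sieve_density qs P L"
    using density_sieved[OF assms(1-3), of 1 1 qs] assms(4,5) by (simp add: subset_iff)
  show "\<exists>N. \<forall>n\<ge>N. density_ratio (sieved 1 1 qs' P L) n \<le> density_ratio (sieved 1 1 qs P L) n"
    using assms(5) by (auto intro!: density_ratio_mono simp: sieved_def)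
qed

text \<open>
  An element \<open>n = p m\<close> of the excluded set satisfies \<open>m = (p - 1) t - b\<close> for some \<open>t\<close>, because
  \<open>p m + b\<close> and \<open>m + b\<close> are congruent modulo \<open>p - 1\<close>. The case \<open>t = 0\<close> is \<open>n = p\<close>. For \<open>t \<ge> 1\<close>
  one has \<open>2 m \<ge> (p - 1) t\<close>, so that no additive error term is needed.
\<close>
lemma card_excluded_le:
  fixes p :: nat
  assumes "p \<ge> 3" "b \<in> {-1, 1}"
  shows "real (card ((excluded 1 b (int p) - {p}) \<inter> {1..N})) \<le> 2 * real N / (real p * (real p - 1))"
proof -
  define T where "T = nat \<lfloor>2 * real N / (real p * (real p - 1))\<rfloor>"
  have ge0: "2 * real N / (real p * (real p - 1)) \<ge> 0" using assms(1) by simp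
  have "(excluded 1 b (int p) - {p}) \<inter> {1..N} \<subseteq> (\<lambda>t. nat (int p * ((int p - 1) * int t - b))) ` {1..T}"
  proof
    fix n assume n: "n \<in> (excluded 1 b (int p) - {p}) \<inter> {1..N}"
    then obtain m where m: "int n = int p * m" by (auto simp: excluded_def)
    have "int p - 1 dvd int p * m + b" using n m by (auto simp: excluded_def)
    also have "int p * m + b = (int p - 1) * m + (m + b)" by (simp add: algebra_simps)
    finally have "int p - 1 dvd m + b" by (simp add: dvd_add_right_iff)
    then obtain t where t: "m + b = (int p - 1) * t" by blast
    have "int p * m > 0" using n m by (metis IntD2 atLeastAtMost_iff of_nat_0_less_iff less_le_trans zero_less_one)
    then have m0: "m > 0" using assms(1) by (simp add: zero_less_mult_iff)
    have m1: "m \<noteq> 1" using n m by auto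
    have t1: "t \<ge> 1"
    proof (rule ccontr)
      assume "\<not> t \<ge> 1"
      then have "(int p - 1) * t \<le> 0" using assms(1) by (intro mult_nonneg_nonpos) auto
      then show False using t m0 m1 assms(2) by auto
    qed
    have "(int p - 1) * t \<ge> 2 * 1" using t1 assms(1) by (intro mult_mono) auto
    then have "(int p - 1) * t \<le> 2 * m" using t assms(2) by auto
    then have "int p * ((int p - 1) * t) \<le> int p * (2 * m)" by (intro mult_left_mono) auto
    then have "int p * ((int p - 1) * t) \<le> 2 * int N" using n m by auto
    then have "real_of_int (int p * ((int p - 1) * t)) \<le> real_of_int (2 * int N)"
      by (simp only: of_int_le_iff)
    then have "real_of_int t \<le> 2 * real N / (real p * (real p - 1))"
      using assms(1) by (simp add: field_simps)
    then have "t \<le> int T" unfolding T_def by (simp add: le_floor_iff)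
    moreover have "n = nat (int p * ((int p - 1) * int (nat t) - b))"
    proof -
      have "(int p - 1) * t - b = m" using t by linarith
      then show ?thesis using t1 by (simp flip: m)
    qed
    ultimately show "n \<in> (\<lambda>t. nat (int p * ((int p - 1) * int t - b))) ` {1..T}"
      using t1 by (intro image_eqI[of _ _ "nat t"]) auto
  qed
  then have "card ((excluded 1 b (int p) - {p}) \<inter> {1..N}) \<le>
      card ((\<lambda>t. nat (int p * ((int p - 1) * int t - b))) ` {1..T})"
    by (intro card_mono) auto
  also have "\<dots> \<le> card {1..T}" by (rule card_image_le) simp
  finally have "real (card ((excluded 1 b (int p) - {p}) \<inter> {1..N})) \<le> real T" by simp
  also have "\<dots> \<le> 2 * real N / (real p * (real p - 1))" unfolding T_def using ge0 by (simp add: of_nat_nat)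
  finally show ?thesis .
qed

lemma sum_inverse_le:
  assumes "Y \<ge> 1"
  shows "(\<Sum>p\<in>{Y<..N}. 1 / (real p * (real p - 1))) \<le> 1 / real Y"
proof -
  have "(\<Sum>p\<in>{Y<..N}. 1 / (real p * (real p - 1))) = 1 / real Y - 1 / real N" if "N \<ge> Y" for N
    using that
  proof (induction N rule: dec_induct)
    case (step N)
    have "{Y<..Suc N} = insert (Suc N) {Y<..N}" using step by auto
    then have "(\<Sum>p\<in>{Y<..Suc N}. 1 / (real p * (real p - 1))) =
        1 / (real (Suc N) * real N) + (1 / real Y - 1 / real N)"
      using step by simp
    also have "1 / (real (Suc N) * real N) = 1 / real N - 1 / real (Suc N)"
      using step assms by (simp add: field_simps)
    finally show ?case by simp
  qed simp
  from this[of N] show ?thesis by (cases "N \<ge> Y") auto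
qed

definition odd_primes :: "nat \<Rightarrow> int list" where
  "odd_primes Y = filter prime [3..int Y]"

lemma set_odd_primes: "set (odd_primes Y) = {p. prime p \<and> 3 \<le> p \<and> p \<le> int Y}"
  by (auto simp: odd_primes_def)

lemma odd_primes_odd: "q \<in> set (odd_primes Y) \<Longrightarrow> odd q \<and> q > 1"
  using prime_odd_int[of q] by (auto simp: set_odd_primes)

definition survivors :: "int \<Rightarrow> int \<Rightarrow> nat set" where
  "survivors c b = {n. c dvd int n + b \<and> (\<forall>p. prime p \<and> p > 2 \<longrightarrow> n \<notin> excluded c b p)}"

lemma survivors_subset_sieved: "survivors c b \<subseteq> sieved c b (odd_primes Y) 1 1"
  by (auto simp: survivors_def sieved_def set_odd_primes)

text \<open>
  The uniform tail estimate: what the primes above \<open>Y\<close> still remove up to \<open>N\<close> consists of primes and of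
  the sets counted in \<open>card_excluded_le\<close>.
\<close>
lemma density_ratio_sieved_le:
  assumes "c \<in> {1, 2}" "b \<in> {-1, 1}" "Y \<ge> 2" "N > 0"
  shows "density_ratio (sieved c b (odd_primes Y) 1 1) N \<le>
    density_ratio (survivors c b) N + real (card {p. prime p \<and> p \<le> N}) / real N + 2 / real Y"
proof -
  let ?S = "sieved c b (odd_primes Y) 1 1" and ?X = "survivors c b"
  let ?B = "\<lambda>p::nat. (excluded 1 b (int p) - {p}) \<inter> {1..N}"
  have "?S \<inter> {1..N} \<subseteq> (?X \<inter> {1..N}) \<union> ({p. prime p \<and> p \<le> N} \<union> (\<Union>p\<in>{Y<..N}. ?B p))"
  proof
    fix n assume n: "n \<in> ?S \<inter> {1..N}"
    show "n \<in> (?X \<inter> {1..N}) \<union> ({p. prime p \<and> p \<le> N} \<union> (\<Union>p\<in>{Y<..N}. ?B p))"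
    proof (cases "n \<in> ?X")
      case True
      then show ?thesis using n by blast
    next
      case False
      then obtain p where p: "prime p" "p > 2" "n \<in> excluded c b p"
        using n by (auto simp: survivors_def sieved_def)
      have pY: "p > int Y"
      proof (rule ccontr)
        assume "\<not> p > int Y"
        then have "p \<in> set (odd_primes Y)" using p(1,2) by (simp add: set_odd_primes)
        then show False using n p(3) by (simp add: sieved_def)
      qed
      have nb: "n \<in> excluded 1 b p" using p(3) by (auto simp: excluded_def intro: dvd_mult_right)
      have "p \<le> int n" using n p(3) by (intro zdvd_imp_le) (auto simp: excluded_def)
      obtain q where q: "p = int q" using p(2) zero_le_imp_eq_int[of p] by auto
      have "n = q \<or> n \<in> ?B q" using nb n by (auto simp: q)
      moreover have "prime q" "q \<in> {Y<..N}"
        using p(1) pY n \<open>p \<le> int n\<close> by (auto simp: q)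
      moreover have "q \<le> N" using \<open>q \<in> {Y<..N}\<close> by simp
      ultimately show ?thesis by blast
    qed
  qed
  then have "card (?S \<inter> {1..N}) \<le>
      card ((?X \<inter> {1..N}) \<union> ({p. prime p \<and> p \<le> N} \<union> (\<Union>p\<in>{Y<..N}. ?B p)))"
    by (intro card_mono) auto
  also have "\<dots> \<le> card (?X \<inter> {1..N}) + card ({p. prime p \<and> p \<le> N} \<union> (\<Union>p\<in>{Y<..N}. ?B p))"
    by (rule card_Un_le)
  also have "card ({p. prime p \<and> p \<le> N} \<union> (\<Union>p\<in>{Y<..N}. ?B p)) \<le>
      card {p. prime p \<and> p \<le> N} + card (\<Union>p\<in>{Y<..N}. ?B p)"
    by (rule card_Un_le)
  also have "card (\<Union>p\<in>{Y<..N}. ?B p) \<le> (\<Sum>p\<in>{Y<..N}. card (?B p))"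
    by (rule card_UN_le) simp
  finally have "real (card (?S \<inter> {1..N})) \<le> real (card (?X \<inter> {1..N}) +
      (card {p. prime p \<and> p \<le> N} + (\<Sum>p\<in>{Y<..N}. card (?B p))))"
    by (simp only: of_nat_le_iff)
  also have "\<dots> = real (card (?X \<inter> {1..N})) +
      (real (card {p. prime p \<and> p \<le> N}) + (\<Sum>p\<in>{Y<..N}. real (card (?B p))))"
    by (simp only: of_nat_add of_nat_sum)
  also have "(\<Sum>p\<in>{Y<..N}. real (card (?B p))) \<le> (\<Sum>p\<in>{Y<..N}. 2 * real N / (real p * (real p - 1)))"
    using assms by (intro sum_mono card_excluded_le) auto
  also have "\<dots> = 2 * real N * (\<Sum>p\<in>{Y<..N}. 1 / (real p * (real p - 1)))"
    by (simp add: sum_distrib_left)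
  also have "\<dots> \<le> 2 * real N * (1 / real Y)"
    using assms by (intro mult_left_mono sum_inverse_le) auto
  finally have "real (card (?S \<inter> {1..N})) / N \<le>
      (real (card (?X \<inter> {1..N})) + (real (card {p. prime p \<and> p \<le> N}) + 2 * real N * (1 / real Y))) / N"
    by (intro divide_right_mono) auto
  then show ?thesis using assms(4) by (simp add: density_ratio_def add_divide_distrib)
qed

lemma decseq_sieve_density: "decseq (\<lambda>Y. sieve_density (odd_primes Y) 1 1)"
proof (intro decseq_SucI sieve_density_antimono)
  show "set (odd_primes Y) \<subseteq> set (odd_primes (Suc Y))" for Y
    by (auto simp: set_odd_primes)
qed (auto dest: odd_primes_odd)

text \<open>
  The sieve density of all odd primes; both densities of the proposition are affine functions of it.
\<close>
definition limit_density :: real where "limit_density = lim (\<lambda>Y. sieve_density (odd_primes Y) 1 1)"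

lemma sieve_density_tendsto: "(\<lambda>Y. sieve_density (odd_primes Y) 1 1) \<longlonglongrightarrow> limit_density"
proof -
  have "sieve_density (odd_primes Y) 1 1 \<ge> 0" for Y
    by (intro sieve_density_nonneg) (auto dest: odd_primes_odd)
  then obtain l where "(\<lambda>Y. sieve_density (odd_primes Y) 1 1) \<longlonglongrightarrow> l"
    using decseq_convergent[OF decseq_sieve_density, of 0] by blast
  then show ?thesis unfolding limit_density_def using convergent_LIMSEQ_iff convergent_def by blast
qed

text \<open>
  For fixed \<open>Y\<close> the ratio of the survivors lies between the ratio of a periodic set and the same ratio
  minus \<open>2 / Y + o(1)\<close>; letting first \<open>N\<close> and then \<open>Y\<close> tend to infinity gives the limit.
\<close>
lemma density_survivors:
  assumes "c \<in> {1, 2}" "b \<in> {-1, 1}"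
  shows "density_ratio (survivors c b) \<longlonglongrightarrow> limit_density / c"
proof (rule LIMSEQ_I)
  fix e :: real assume e: "e > 0"
  let ?g = "\<lambda>Y. density_ratio (sieved c b (odd_primes Y) 1 1)" and ?d = "\<lambda>Y. sieve_density (odd_primes Y) 1 1 / c"
  have g: "?g Y \<longlonglongrightarrow> ?d Y" for Y
    using assms by (intro density_sieved) (auto dest: odd_primes_odd)
  have "?d \<longlonglongrightarrow> limit_density / c" using sieve_density_tendsto assms(1) by (intro tendsto_divide) auto
  then have "\<forall>\<^sub>F Y in sequentially. dist (?d Y) (limit_density / c) < e / 4"
    using e by (intro tendstoD) auto
  moreover have "\<forall>\<^sub>F Y in sequentially. dist (2 / real Y) 0 < e / 4"
    using e lim_const_over_n[of 2] by (intro tendstoD) auto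
  ultimately have "\<forall>\<^sub>F Y in sequentially. dist (?d Y) (limit_density / c) < e / 4 \<and> 2 / real Y < e / 4 \<and> Y \<ge> 2"
    using eventually_ge_at_top[of 2] by eventually_elim (auto simp: dist_real_def)
  then obtain Y where Y: "dist (?d Y) (limit_density / c) < e / 4" "2 / real Y < e / 4" "Y \<ge> 2"
    using eventually_happens by force
  have "\<forall>\<^sub>F N in sequentially. dist (?g Y N) (?d Y) < e / 4"
    using e by (intro tendstoD[OF g]) auto
  moreover have "\<forall>\<^sub>F N in sequentially. dist (real (card {p. prime p \<and> p \<le> N}) / real N) 0 < e / 4"
    using e by (intro tendstoD[OF primes_density_zero]) auto
  ultimately have "\<forall>\<^sub>F N in sequentially. norm (density_ratio (survivors c b) N - limit_density / c) < e"
    using eventually_gt_at_top[of 0]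
  proof eventually_elim
    case (elim N)
    have "density_ratio (survivors c b) N \<le> ?g Y N"
      by (intro density_ratio_mono survivors_subset_sieved)
    moreover have "?g Y N \<le> density_ratio (survivors c b) N +
        real (card {p. prime p \<and> p \<le> N}) / real N + 2 / real Y"
      using assms Y elim by (intro density_ratio_sieved_le) auto
    ultimately show ?case using elim Y(1,2) unfolding dist_real_def real_norm_def by linarith
  qed
  then show "\<exists>no. \<forall>n\<ge>no. norm (density_ratio (survivors c b) n - limit_density / c) < e"
    by (simp add: eventually_sequentially)
qed

section \<open>The two sets as survivor sets\<close>

lemma not_excluded_iff:
  assumes "odd n"
  shows "(\<forall>p. prime p \<and> p > 2 \<longrightarrow> n \<notin> excluded c b p) \<longleftrightarrow>
    (\<forall>p. prime p \<and> p dvd n \<longrightarrow> \<not> c * (int p - 1) dvd int n + b)" (is "?L \<longleftrightarrow> ?R")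
proof
  assume L: ?L
  show ?R
  proof (intro allI impI)
    fix p assume p: "prime p \<and> p dvd n"
    then have "p \<noteq> 2" using assms(1) by auto
    with p have "p > 2" using prime_ge_2_nat[of p] by simp
    with L p show "\<not> c * (int p - 1) dvd int n + b" by (auto simp: excluded_def)
  qed
next
  assume R: ?R
  show ?L
  proof (intro allI impI)
    fix p :: int assume p: "prime p \<and> p > 2"
    then obtain q where "p = int q" using zero_le_imp_eq_int[of p] by auto
    with R p show "n \<notin> excluded c b p" by (auto simp: excluded_def)
  qed
qed

lemma even_in_survivors:
  assumes "even n" "b \<in> {-1, 1}"
  shows "n \<in> survivors 1 b"
proof -
  have "n \<notin> excluded 1 b p" if "prime p" "p > 2" for p
  proof
    assume "n \<in> excluded 1 b p"
    then have "p - 1 dvd int n + b" by (simp add: excluded_def)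
    moreover have "even (p - 1)" using that prime_odd_int by simp
    ultimately have "even (int n + b)" by (rule dvd_trans[rotated])
    then show False using assms by auto
  qed
  then show ?thesis by (simp add: survivors_def)
qed

text \<open>
  Even numbers always survive, since \<open>p - 1\<close> is even and \<open>n + b\<close> is odd; among them the class
  \<open>2 mod 4\<close> has to be taken out.
\<close>
lemma M_set_f1_iff:
  assumes "b \<in> {-1, 1}" "n \<ge> 1"
  shows "n \<in> M_set (f1 b) \<longleftrightarrow> n \<in> survivors 1 b - {n. [int n = 2] (mod 4)}"
proof -
  have k: "int (f1 b n) = int n + b" using assms by (auto simp: f1_def)
  have M: "n \<in> M_set (f1 b) \<longleftrightarrow> n dvd power_sum (f1 b n) n"
    using assms(2) by (simp add: M_set_def)
  consider "n = 1" | "odd n" "n > 1" | "even n" using assms(2) by force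
  then show ?thesis
  proof cases
    case 1
    then show ?thesis unfolding M
      by (auto simp: survivors_def excluded_def cong_def)
  next
    case 2
    have "int n mod 4 \<noteq> 2" using 2(1) by presburger
    then have notin: "n \<notin> {n. [int n = 2] (mod 4)}" by (simp add: cong_def)
    have "f1 b n > 0" using k 2 assms(1) by auto
    then have "n \<in> M_set (f1 b) \<longleftrightarrow> (\<forall>p. prime p \<and> p dvd n \<longrightarrow> \<not> p - 1 dvd f1 b n)"
      using 2 M dvd_power_sum_iff_odd by simp
    also have "\<dots> \<longleftrightarrow> (\<forall>p. prime p \<and> p dvd n \<longrightarrow> \<not> 1 * (int p - 1) dvd int n + b)"
    proof -
      have "p - 1 dvd f1 b n \<longleftrightarrow> 1 * (int p - 1) dvd int n + b" if "prime p" for p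
        using prime_ge_1_nat[OF that] by (simp flip: k add: of_nat_diff int_dvd_int_iff[symmetric])
      then show ?thesis by blast
    qed
    also have "\<dots> \<longleftrightarrow> n \<in> survivors 1 b"
      using not_excluded_iff[OF 2(1), of 1 b] by (simp add: survivors_def)
    finally show ?thesis using notin by simp
  next
    case 3
    have odd: "odd (int n + b)" using 3 assms(1) by auto
    have "n \<in> survivors 1 b" using even_in_survivors[OF 3 assms(1)] .
    moreover have "odd (f1 b n)" using odd k by (metis even_of_nat)
    moreover have "f1 b n > 1 \<or> \<not> 4 dvd n"
      using k assms dvd_imp_le[of 4 n] by auto
    ultimately have "n \<in> M_set (f1 b) \<longleftrightarrow> 4 dvd n"
      using M dvd_power_sum_iff_even 3 assms(2) by simp
    also have "\<dots> \<longleftrightarrow> \<not> [int n = 2] (mod 4)"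
      using 3 by (simp add: cong_def) presburger
    finally show ?thesis using \<open>n \<in> survivors 1 b\<close> by simp
  qed
qed

text \<open>
  Writing \<open>n = 2 k + 1\<close>, the condition \<open>p - 1 dvd k\<close> reads \<open>2 (p - 1) dvd n - 1\<close>, and \<open>n\<close> being odd
  reads \<open>2 dvd n - 1\<close>.
\<close>
lemma P_set_iff:
  assumes "n \<ge> 1"
  shows "n \<in> P_set \<longleftrightarrow> n \<in> survivors 2 (-1)"
proof -
  consider "n = 1" | "odd n" "n > 1" | "even n" using assms by force
  then show ?thesis
  proof cases
    case 1
    then show ?thesis by (auto simp: P_set_def survivors_def excluded_def)
  next
    case 2
    define k where "k = (n - 1) div 2"
    have n: "n = 2 * k + 1" using 2 by (simp add: k_def)
    have "n \<in> P_set \<longleftrightarrow> n dvd power_sum k n"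
      using 2 by (simp add: P_set_def k_def cong_0_iff)
    also have "\<dots> \<longleftrightarrow> (\<forall>p. prime p \<and> p dvd n \<longrightarrow> \<not> p - 1 dvd k)"
      using 2 n by (intro dvd_power_sum_iff_odd) auto
    also have "\<dots> \<longleftrightarrow> (\<forall>p. prime p \<and> p dvd n \<longrightarrow> \<not> 2 * (int p - 1) dvd int n + -1)"
    proof -
      have "p - 1 dvd k \<longleftrightarrow> 2 * (int p - 1) dvd int n + -1" if "prime p" for p
      proof -
        have "p - 1 dvd k \<longleftrightarrow> int (p - 1) dvd int k" by (simp only: of_nat_dvd_iff)
        also have "\<dots> \<longleftrightarrow> 2 * (int p - 1) dvd 2 * int k"
          using prime_ge_1_nat[OF that]
          by (simp only: of_nat_diff of_nat_1 dvd_times_left_cancel_iff zero_neq_numeral)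
        also have "2 * int k = int n + -1" by (simp add: n)
        finally show ?thesis .
      qed
      then show ?thesis by blast
    qed
    also have "\<dots> \<longleftrightarrow> n \<in> survivors 2 (-1)"
      using not_excluded_iff[OF 2(1), of 2 "-1"] 2 by (simp add: survivors_def)
    finally show ?thesis .
  next
    case 3
    then show ?thesis by (auto simp: P_set_def survivors_def)
  qed
qed

lemma density_M_set:
  assumes "b \<in> {-1, 1}"
  shows "density_ratio (M_set (f1 b)) \<longlonglongrightarrow> limit_density - 1 / 4"
proof -
  have "{n. [int n = 2] (mod 4)} \<subseteq> survivors 1 b"
  proof
    fix n assume "n \<in> {n. [int n = 2] (mod 4)}"
    then have "int n mod 4 = 2" by (simp add: cong_def)
    then have "even n" by presburger
    then show "n \<in> survivors 1 b" using assms by (rule even_in_survivors)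
  qed
  then have "density_ratio (survivors 1 b - {n. [int n = 2] (mod 4)}) \<longlonglongrightarrow> limit_density / 1 - 1 / 4"
    using density_survivors[of 1 b] density_arith_progression[of 4 2] assms
    by (intro density_ratio_diff) auto
  moreover have "density_ratio (M_set (f1 b)) = density_ratio (survivors 1 b - {n. [int n = 2] (mod 4)})"
    using M_set_f1_iff[OF assms] by (rule density_ratio_cong)
  ultimately show ?thesis by simp
qed

lemma density_P_set: "density_ratio P_set \<longlonglongrightarrow> limit_density / 2"
proof -
  have "density_ratio P_set = density_ratio (survivors 2 (-1))"
    using P_set_iff by (rule density_ratio_cong)
  then show ?thesis using density_survivors[of 2 "-1"] by simp
qed

section \<open>Numerical enclosure of the limit density\<close>

lemma sieve_density_eq_0: "\<not> coprime P L \<Longrightarrow> sieve_density qs P L = 0"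
proof (induction qs arbitrary: P L)
  case (Cons q qs)
  have "\<not> coprime (lcm P q) (lcm L (q - 1))"
    using Cons.prems by (meson coprime_divisors dvd_lcm1)
  with Cons show ?case by simp
qed simp

lemma sieve_density_le:
  assumes "odd P" "P > 0" "L > 0" "\<And>q. q \<in> set qs \<Longrightarrow> odd q \<and> q > 1"
  shows "sieve_density qs P L \<le> 1 / (real_of_int P * real_of_int L)"
proof -
  have "sieve_density qs P L \<le> sieve_density [] P L"
    using sieve_density_antimono[OF assms(1-3), of qs "[]"] assms(4) by simp
  also have "\<dots> \<le> 1 / (real_of_int P * real_of_int L)" using assms(2,3) by simp
  finally show ?thesis .
qed

text \<open>
  An enclosure of \<open>K\<close> times the sieve density, from above or from below according to the flag. A class
  with \<open>P L > T\<close> is not split further: its sieve density lies between \<open>0\<close> and \<open>1 / (P L)\<close>.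
\<close>
primrec estimate :: "int \<Rightarrow> int \<Rightarrow> int list \<Rightarrow> bool \<Rightarrow> int \<Rightarrow> int \<Rightarrow> int" where
  "estimate K T [] u P L = (if gcd P L = 1 then K div (P * L) + (if u then 1 else 0) else 0)"
| "estimate K T (q # qs) u P L =
    (if gcd P L \<noteq> 1 then 0
     else if T < P * L then (if u then K div (P * L) + 1 else 0)
     else estimate K T qs u P L - estimate K T qs (\<not> u) (lcm P q) (lcm L (q - 1)))"

lemma div_bounds:
  assumes "m > 0"
  shows "real_of_int (K div m) \<le> K / m" "K / m \<le> real_of_int (K div m) + 1"
  using assms floor_correct[of "K / m"] by (auto simp: floor_divide_of_int_eq)

lemma estimate_bounds:
  assumes "K \<ge> 0" "odd P" "P > 0" "L > 0" "\<And>q. q \<in> set qs \<Longrightarrow> odd q \<and> q > 1"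
  shows "estimate K T qs False P L \<le> K * sieve_density qs P L \<and>
    K * sieve_density qs P L \<le> estimate K T qs True P L"
  using assms(2-)
proof (induction qs arbitrary: P L)
  case Nil
  then show ?case
    using div_bounds[of "P * L" K] by (auto simp: coprime_iff_gcd_eq_1)
next
  case (Cons q qs)
  have q: "odd q" "q > 1" using Cons.prems(4) by auto
  have pos: "lcm P q > 0" "lcm L (q - 1) > 0"
    using Cons.prems(2,3) q(2) by (simp_all add: lcm_pos_int)
  have "lcm P q dvd P * q" by simp
  then have oddl: "odd (lcm P q)"
    using Cons.prems(1) q(1) by (meson dvd_trans even_mult_iff)
  have PL: "P * L > 0" using Cons.prems by simp
  have nn: "0 \<le> sieve_density (q # qs) P L" by (rule sieve_density_nonneg) (use Cons.prems in auto)
  have "sieve_density (q # qs) P L \<le> 1 / (real_of_int P * real_of_int L)"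
    by (rule sieve_density_le) (use Cons.prems in auto)
  then have "real_of_int K * sieve_density (q # qs) P L \<le> K * (1 / (real_of_int P * real_of_int L))"
    using assms(1) by (intro mult_left_mono) simp_all
  also have "\<dots> \<le> real_of_int (K div (P * L)) + 1"
    using div_bounds(2)[OF PL, of K] by simp
  finally have ub: "real_of_int K * sieve_density (q # qs) P L \<le> real_of_int (K div (P * L)) + 1" .
  have lb: "0 \<le> real_of_int K * sieve_density (q # qs) P L" using nn assms(1) by simp
  have IH1: "estimate K T qs False P L \<le> K * sieve_density qs P L \<and>
      K * sieve_density qs P L \<le> estimate K T qs True P L"
    using Cons.prems by (intro Cons.IH) auto
  have IH2: "estimate K T qs False (lcm P q) (lcm L (q - 1)) \<le>
      K * sieve_density qs (lcm P q) (lcm L (q - 1)) \<and>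
      K * sieve_density qs (lcm P q) (lcm L (q - 1)) \<le> estimate K T qs True (lcm P q) (lcm L (q - 1))"
    using Cons.prems pos oddl by (intro Cons.IH) auto
  consider "\<not> coprime P L" | "coprime P L" "T < P * L" | "coprime P L" "\<not> T < P * L" by blast
  then show ?case
  proof cases
    case 1
    then have "sieve_density (q # qs) P L = 0" by (rule sieve_density_eq_0)
    moreover have "gcd P L \<noteq> 1" using 1 by (simp add: coprime_iff_gcd_eq_1)
    ultimately show ?thesis by (simp del: sieve_density.simps)
  next
    case 2
    then show ?thesis using lb ub by (simp add: coprime_iff_gcd_eq_1 del: sieve_density.simps)
  next
    case 3
    then show ?thesis using IH1 IH2 by (simp add: coprime_iff_gcd_eq_1 right_diff_distrib)
  qed
qed

lemmas estimate_upper = estimate_bounds[THEN conjunct2]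

text \<open>
  The union bound: the primes in \<open>ps\<close> remove from the numbers that survive \<open>qs\<close> no more than the sum
  of their individual contributions.
\<close>
lemma sieve_density_append_ge:
  assumes "\<And>q. q \<in> set (ps @ qs) \<Longrightarrow> odd q \<and> q > 1"
  shows "sieve_density (ps @ qs) 1 1 \<ge> sieve_density qs 1 1 - (\<Sum>p\<leftarrow>ps. sieve_density qs p (p - 1))"
  using assms
proof (induction ps)
  case (Cons p ps)
  have p: "odd p" "p > 1" using Cons.prems[of p] by auto
  have "sieve_density (ps @ qs) p (p - 1) \<le> sieve_density qs p (p - 1)"
  proof (rule sieve_density_antimono)
    show "odd q \<and> q > 1" if "q \<in> set (ps @ qs)" for q using Cons.prems[of q] that by simp
  qed (use p in simp_all)
  moreover have "sieve_density (ps @ qs) 1 1 \<ge> sieve_density qs 1 1 - (\<Sum>p\<leftarrow>ps. sieve_density qs p (p - 1))"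
    using Cons.prems by (intro Cons.IH) auto
  moreover have "p > 0" using p by linarith
  ultimately show ?case by simp
qed simp

text \<open>
  The primes above 3 are among the numbers \<open>6 k \<plusminus> 1\<close>. The two terms of index \<open>k\<close> are together at most
  \<open>2 / ((6 k + 2) (6 k - 4))\<close>, which telescopes. The symmetric choice
  \<open>(6 k + 3) (6 k - 3)\<close> of the denominator fails already for \<open>k = 2\<close>.
\<close>
lemma sum_over_wheel_le:
  assumes "m \<ge> 1"
  shows "(\<Sum>k\<in>{m..n}. 1 / (real_of_int (6 * k - 1) * (6 * k - 2)) + 1 / (real_of_int (6 * k + 1) * (6 * k)))
    \<le> 1 / (3 * (6 * real_of_int m - 4))" (is "sum ?f _ \<le> _")
proof -
  have "sum ?f {m..n} \<le> 1 / (3 * (6 * real_of_int m - 4)) - 1 / (3 * (6 * real_of_int n + 2))"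
    if "n \<ge> m - 1" for n
    using that
  proof (induction n rule: int_ge_induct)
    case (step n)
    have x: "real_of_int n + 1 \<ge> 1" using step assms by linarith
    define x where "x = real_of_int n + 1"
    have x1: "x \<ge> 1" using x by (simp add: x_def)
    have "{m..n + 1} = insert (n + 1) {m..n}" using step by auto
    then have "sum ?f {m..n + 1} = ?f (n + 1) + sum ?f {m..n}" by simp
    also have "?f (n + 1) = 1 / ((6 * x - 1) * (6 * x - 2)) + 1 / ((6 * x + 1) * (6 * x))"
      by (simp add: x_def algebra_simps)
    also have "\<dots> \<le> 1 / (3 * (6 * x - 4)) - 1 / (3 * (6 * x + 2))"
    proof -
      define u v w where "u = (6 * x - 1) * (6 * x - 2)" and "v = (6 * x + 1) * (6 * x)"
        and "w = (6 * x + 2) * (6 * x - 4)"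
      have pos: "u > 0" "v > 0" "w > 0" using x1 by (simp_all add: u_def v_def w_def)
      have "2 * (u * v) - w * (u + v) = 432 * x ^ 3 + 240 * x\<^sup>2 + 48 * (x * (x - 1)) + 16"
        by (simp add: u_def v_def w_def algebra_simps power2_eq_square power3_eq_cube)
      moreover have "x * (x - 1) \<ge> 0" using x1 by simp
      ultimately have "w * (u + v) \<le> 2 * (u * v)"
        using x1 by (smt (verit) zero_le_power zero_le_power2)
      then have "1 / u + 1 / v \<le> 2 * (1 / w)"
        using pos by (simp add: field_simps)
      moreover have "1 / (3 * (6 * x - 4)) - 1 / (3 * (6 * x + 2)) = 2 * (1 / w)"
        using x1 by (simp add: w_def divide_simps) (simp add: algebra_simps)
      ultimately show ?thesis by (simp add: u_def v_def)
    qed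
    finally show ?case using step by (simp add: x_def algebra_simps)
  qed (use assms in auto)
  note telescope = this
  show ?thesis
  proof (cases "n \<ge> m - 1")
    case True
    have "1 / (3 * (6 * real_of_int n + 2)) \<ge> 0" using True assms by simp
    then show ?thesis using telescope[OF True] by linarith
  next
    case False
    then show ?thesis using assms by simp
  qed
qed

abbreviation scale :: int where
  "scale \<equiv> 100000000"

text \<open>
  Cutting at 48 puts every larger prime in the form \<open>6 k \<plusminus> 1\<close> with \<open>k \<ge> 9\<close>, as 49 is not prime.
\<close>
definition small_primes :: "int list" where
  "small_primes = [47, 43, 41, 37, 31, 29, 23, 19, 17, 13, 11, 7, 5, 3]"

text \<open>
  The number 33426748355 is \<open>5 \<sqdot> 7 \<sqdot> 11 \<sqdot> \<dots> \<sqdot> 31\<close>. A number \<open>6 k \<plusminus> 1\<close> with \<open>9 \<le> k \<le> 160\<close> is at most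
  \<open>961 = 31\<^sup>2\<close>, so those coprime to it are exactly the primes in this range. For each of them the
  removed part is bounded after sieving by 3, 5 and 7 alone.
\<close>
definition wheel_term :: "int \<Rightarrow> int" where
  "wheel_term n = (if gcd n 33426748355 = 1 then estimate scale 1000000 [7, 5, 3] True n (n - 1) else 0)"

text \<open>
  The unknowns of the schematic goals are instantiated by the computed values 76089867, 252842 and
  75958560; the bounds stated after them are rounded.
\<close>
schematic_goal estimate_small_primes_value: "estimate scale 300000 small_primes False 1 1 = ?n"
  by code_simp

lemma estimate_small_primes: "estimate scale 300000 small_primes False 1 1 \<ge> 76089000"
  unfolding estimate_small_primes_value by simp

schematic_goal sum_wheel_term_value:
  "(\<Sum>k\<leftarrow>[9..160]. wheel_term (6 * k - 1) + wheel_term (6 * k + 1)) = ?n"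
  by code_simp

lemma sum_wheel_term: "(\<Sum>k\<leftarrow>[9..160]. wheel_term (6 * k - 1) + wheel_term (6 * k + 1)) \<le> 253000"
  unfolding sum_wheel_term_value by simp

text \<open>
  Any finite set of odd primes gives an upper bound for the limit density; the primes up to 167 suffice
  for the required precision.
\<close>
definition upper_primes :: "int list" where
  "upper_primes = [
    167, 163, 157, 151, 149, 139, 137, 131, 127, 113, 109, 107, 103, 101, 97, 89, 83,
    79, 73, 71, 67, 61, 59, 53, 47, 43, 41, 37, 31, 29, 23, 19, 17, 13, 11, 7, 5, 3]"

schematic_goal estimate_upper_primes_value: "estimate scale 100000 upper_primes True 1 1 = ?n"
  by code_simp

lemma estimate_upper_primes: "estimate scale 100000 upper_primes True 1 1 \<le> 75966000"
  unfolding estimate_upper_primes_value by simp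

lemma limit_density_le: "limit_density \<le> 75966 / 100000"
proof -
  have sub: "set upper_primes \<subseteq> set (odd_primes 170)"
    unfolding upper_primes_def set_odd_primes by simp
  have "limit_density \<le> sieve_density (odd_primes 170) 1 1"
    using decseq_sieve_density sieve_density_tendsto by (rule decseq_ge)
  also have "\<dots> \<le> sieve_density upper_primes 1 1"
    by (rule sieve_density_antimono[OF _ _ _ _ sub]) (auto dest: odd_primes_odd)
  also have "scale * sieve_density upper_primes 1 1 \<le> estimate scale 100000 upper_primes True 1 1"
    using estimate_bounds[of scale 1 1 upper_primes 100000] sub by (auto dest: odd_primes_odd)
  then have "sieve_density upper_primes 1 1 \<le> 75966 / 100000"
    using estimate_upper_primes by linarith
  finally show ?thesis .
qed

lemma prime_mod_6:
  assumes "prime (p::int)" "p > 3"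
  obtains k where "p = 6 * k - 1 \<or> p = 6 * k + 1"
proof -
  have "\<not> 2 dvd p" "\<not> 3 dvd p"
    using assms primes_dvd_imp_eq[of 2 p] primes_dvd_imp_eq[of 3 p] by auto
  then have "p mod 6 = 1 \<or> p mod 6 = 5" by presburger
  then have "p = 6 * (p div 6) + 1 \<or> p = 6 * (p div 6 + 1) - 1" by presburger
  then show ?thesis using that by blast
qed

lemma set_small_primes: "prime p \<Longrightarrow> 3 \<le> p \<Longrightarrow> p \<le> 48 \<Longrightarrow> p \<in> set small_primes"
proof -
  assume p: "prime p" "3 \<le> p" "p \<le> 48"
  then have "p \<in> set [3..48]" by (simp only: set_upto atLeastAtMost_iff)
  with p(1) show ?thesis by (auto simp: small_primes_def)
qed

lemma small_primes_odd: "q \<in> set small_primes \<Longrightarrow> odd q \<and> q > 1"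
  by (auto simp: small_primes_def)

lemma sieve_density_le_wheel_term:
  assumes "prime p" "p > 48"
  shows "scale * sieve_density small_primes p (p - 1) \<le> wheel_term p"
proof -
  have "odd p" using assms prime_odd_int by force
  have "coprime p q" if "prime q" "q < 48" for q
    using that assms by (intro primes_coprime) auto
  then have "coprime p (5*7*11*13*17*19*23*29*31)"
    by (intro coprime_mult_right_iff[THEN iffD2] conjI) simp_all
  then have "gcd p 33426748355 = 1" by (simp add: coprime_iff_gcd_eq_1)
  then have eq: "wheel_term p = estimate scale 1000000 [7, 5, 3] True p (p - 1)"
    by (simp add: wheel_term_def del: estimate.simps)
  have "sieve_density small_primes p (p - 1) \<le> sieve_density [7, 5, 3] p (p - 1)"
    using assms(2) \<open>odd p\<close> by (intro sieve_density_antimono) (auto simp: small_primes_def)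
  then have "scale * sieve_density small_primes p (p - 1) \<le> scale * sieve_density [7, 5, 3] p (p - 1)" by simp
  also have "\<dots> \<le> wheel_term p"
    unfolding eq by (rule estimate_upper) (use assms(2) \<open>odd p\<close> in auto)
  finally show ?thesis .
qed

lemma wheel_term_nonneg:
  assumes "odd p" "p > 1"
  shows "wheel_term p \<ge> 0"
proof -
  have "0 \<le> sieve_density [7, 5, 3] p (p - 1)" by (rule sieve_density_nonneg) (use assms in auto)
  then have "0 \<le> scale * sieve_density [7, 5, 3] p (p - 1)" by simp
  also have "\<dots> \<le> estimate scale 1000000 [7, 5, 3] True p (p - 1)"
    by (rule estimate_upper) (use assms in auto)
  finally show ?thesis by (simp add: wheel_term_def del: estimate.simps)
qed

text \<open>
  The numbers fit together as \<open>76089000 - 253000 - 34651 \<ge> 75801000\<close>: the sieve by the small primes, the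
  primes between 48 and 961, and \<open>1 / (3 \<sqdot> 962)\<close> for all larger ones, in units of \<open>1 / scale\<close>.
\<close>
lemma limit_density_ge: "limit_density \<ge> 75801 / 100000"
proof (rule LIMSEQ_le_const[OF sieve_density_tendsto], intro exI allI impI)
  fix Y :: nat
  define ps where "ps = filter (\<lambda>p. p > 48) (odd_primes Y)"
  have ps: "p \<in> set ps \<longleftrightarrow> prime p \<and> p > 48 \<and> p \<le> int Y" for p
    by (auto simp: ps_def set_odd_primes)
  define g where "g p = (if prime p then sieve_density small_primes p (p - 1) else 0)" for p
  have good: "odd q \<and> q > 1" if "q \<in> set (ps @ small_primes)" for q
    using that small_primes_odd odd_primes_odd by (auto simp: ps_def)
  have g_nonneg: "g p \<ge> 0" if "odd p" "p > 1" for p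
    using sieve_density_nonneg[of p "p - 1" small_primes] that small_primes_odd by (simp add: g_def)
  let ?I = "{9..max 160 (int Y)}"
  have "(\<Sum>p\<leftarrow>ps. sieve_density small_primes p (p - 1)) = (\<Sum>p\<in>set ps. sieve_density small_primes p (p - 1))"
    by (rule sum_list_distinct_conv_sum_set) (simp add: ps_def odd_primes_def)
  also have "\<dots> = (\<Sum>p\<in>set ps. g p)" using ps by (intro sum.cong) (auto simp: g_def)
  also have "\<dots> \<le> (\<Sum>p\<in>(\<lambda>k. 6 * k - 1) ` ?I \<union> (\<lambda>k. 6 * k + 1) ` ?I. g p)"
  proof (rule sum_mono2)
    show "set ps \<subseteq> (\<lambda>k. 6 * k - 1) ` ?I \<union> (\<lambda>k. 6 * k + 1) ` ?I"
    proof
      fix p assume "p \<in> set ps"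
      then have p: "prime p" "p > 48" "p \<le> int Y" using ps by auto
      then obtain k where k: "p = 6 * k - 1 \<or> p = 6 * k + 1" using prime_mod_6[of p] by auto
      \<comment> \<open>only \<open>49 = 6 \<sqdot> 8 + 1\<close> exceeds 48 with an index below 9\<close>
      have "\<not> 7 dvd p" using p primes_dvd_imp_eq[of 7 p] by auto
      then have "p \<noteq> 49" by auto
      then have "k \<in> ?I" using p k by auto
      then show "p \<in> (\<lambda>k. 6 * k - 1) ` ?I \<union> (\<lambda>k. 6 * k + 1) ` ?I" using k by blast
    qed
  qed (use g_nonneg in auto)
  also have "\<dots> = (\<Sum>p\<in>(\<lambda>k. 6 * k - 1) ` ?I. g p) + (\<Sum>p\<in>(\<lambda>k. 6 * k + 1) ` ?I. g p)"
    by (rule sum.union_disjoint) (auto, presburger)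
  also have "\<dots> = (\<Sum>k\<in>?I. g (6 * k - 1) + g (6 * k + 1))"
    by (simp add: sum.reindex inj_on_def sum.distrib)
  also have "?I = {9..160} \<union> {161..max 160 (int Y)}" by auto
  also have "(\<Sum>k\<in>{9..160} \<union> {161..max 160 (int Y)}. g (6 * k - 1) + g (6 * k + 1)) =
      (\<Sum>k\<in>{9..160}. g (6 * k - 1) + g (6 * k + 1)) +
      (\<Sum>k\<in>{161..max 160 (int Y)}. g (6 * k - 1) + g (6 * k + 1))"
    by (rule sum.union_disjoint) auto
  finally have split: "(\<Sum>p\<leftarrow>ps. sieve_density small_primes p (p - 1)) \<le>
      (\<Sum>k\<in>{9..160}. g (6 * k - 1) + g (6 * k + 1)) +
      (\<Sum>k\<in>{161..max 160 (int Y)}. g (6 * k - 1) + g (6 * k + 1))" .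
  have g_le: "scale * g p \<le> wheel_term p" if "odd p" "p > 48" for p
    using sieve_density_le_wheel_term[of p] wheel_term_nonneg[of p] that by (auto simp: g_def)
  have "scale * (\<Sum>k\<in>{9..160}. g (6 * k - 1) + g (6 * k + 1)) =
      (\<Sum>k\<in>{9..160}. scale * g (6 * k - 1) + scale * g (6 * k + 1))"
    by (simp add: sum_distrib_left distrib_left)
  also have "\<dots> \<le> (\<Sum>k\<in>{9..160}. real_of_int (wheel_term (6 * k - 1)) + real_of_int (wheel_term (6 * k + 1)))"
    by (intro sum_mono add_mono g_le) auto
  also have "\<dots> = real_of_int (\<Sum>k\<in>{9..160}. wheel_term (6 * k - 1) + wheel_term (6 * k + 1))"
    by (simp only: of_int_sum of_int_add)
  also have "(\<Sum>k\<in>{9..160}. wheel_term (6 * k - 1) + wheel_term (6 * k + 1)) =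
      (\<Sum>k\<leftarrow>[9..160]. wheel_term (6 * k - 1) + wheel_term (6 * k + 1))"
    by (simp only: interv_sum_list_conv_sum_set_int set_upto)
  also have "\<dots> \<le> 253000" using sum_wheel_term by linarith
  finally have part1: "(\<Sum>k\<in>{9..160}. g (6 * k - 1) + g (6 * k + 1)) \<le> 253000 / scale" by simp
  have g_le': "g p \<le> 1 / (real_of_int p * (p - 1))" if "odd p" "p > 1" for p
    using sieve_density_le[of p "p - 1" small_primes] that small_primes_odd by (auto simp: g_def)
  have "(\<Sum>k\<in>{161..max 160 (int Y)}. g (6 * k - 1) + g (6 * k + 1)) \<le>
    (\<Sum>k\<in>{161..max 160 (int Y)}. 1 / (real_of_int (6 * k - 1) * (6 * k - 2)) +
      1 / (real_of_int (6 * k + 1) * (6 * k)))"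
    using g_le'[of "6 * _ - 1"] g_le'[of "6 * _ + 1"] by (intro sum_mono add_mono) force+
  also have "\<dots> \<le> 1 / (3 * (6 * real_of_int 161 - 4))" by (rule sum_over_wheel_le) simp
  finally have part2: "(\<Sum>k\<in>{161..max 160 (int Y)}. g (6 * k - 1) + g (6 * k + 1)) \<le> 34651 / scale" by simp
  have "scale * sieve_density small_primes 1 1 \<ge> 76089000"
    using estimate_bounds[of scale 1 1 small_primes 300000] estimate_small_primes small_primes_odd by force
  moreover have "sieve_density small_primes 1 1 - (\<Sum>p\<leftarrow>ps. sieve_density small_primes p (p - 1)) \<le>
      sieve_density (ps @ small_primes) 1 1"
    using good by (rule sieve_density_append_ge)
  moreover have "sieve_density (ps @ small_primes) 1 1 \<le> sieve_density (odd_primes Y) 1 1"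
  proof (rule sieve_density_antimono)
    show "set (odd_primes Y) \<subseteq> set (ps @ small_primes)"
    proof
      fix p assume "p \<in> set (odd_primes Y)"
      then show "p \<in> set (ps @ small_primes)"
        using set_small_primes[of p] by (cases "p \<le> 48") (auto simp: ps set_odd_primes)
    qed
  qed (use good in auto)
  ultimately show "75801 / 100000 \<le> sieve_density (odd_primes Y) 1 1" using split part1 part2 by simp
qed

section \<open>The proposition\<close>

theorem proposition9:
  fixes b :: int
  assumes "b \<in> {-1, 1}"
  shows "has_density (M_set (f1 b)) \<and> has_density P_set \<and>
    density (M_set (f1 b)) = 2 * density P_set - 1 / 4 \<and>
    density (M_set (f1 b)) \<in> {50801 / 100000 .. 50966 / 100000}"
proof -
  have M: "density_ratio (M_set (f1 b)) \<longlonglongrightarrow> limit_density - 1 / 4"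
    using assms by (rule density_M_set)
  have "has_density (M_set (f1 b))" "has_density P_set"
    using M density_P_set by (auto simp: has_density_def convergent_def)
  moreover have "density (M_set (f1 b)) = limit_density - 1 / 4" "density P_set = limit_density / 2"
    using limI[OF M] limI[OF density_P_set] by (simp_all add: density_def)
  ultimately show ?thesis using limit_density_ge limit_density_le by simp
qed

end
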